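(* Let $W$ be a finite irreducible Coxeter group of rank $n$ with degrees $d_1\le d_2\le\dots\le d_n$, and let $k$ be a positive integer. Then $$\mathrm{Cat}^{(k)}\{W\}=\prod_{j=1}^n\frac{\{d_j+kd_n\}}{\{d_j\}}$$ lies in $\mathbb{N}[s,t]$.
   Context: Let $s,t$ be variables; the Lucas polynomials are $\{0\}=0$, $\{1\}=1$, $\{m\}=s\{m-1\}+t\{m-2\}$ for $m\ge2$. $\mathbb{N}$ denotes the nonnegative integers. The finite irreducible Coxeter groups and their degrees (listed as a multiset; $d_n$ is the largest) are: $A_n$: $2,3,\dots,n+1$; $B_n$: $2,4,\dots,2n$; $D_n$: $2,4,\dots,2n-2,n$; $E_6$: $2,5,6,8,9,12$; $E_7$: $2,6,8,10,12,14,18$; $E_8$: $2,8,12,14,18,20,24,30$; $F_4$: $2,6,8,12$; $H_3$: $2,6,10$; $H_4$: $2,12,20,30$; $I_2(m)$: $2,m$. *)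

theory Defs
  imports
    "HOL-Library.Multiset"
    "HOL-Computational_Algebra.Polynomial"
    "HOL-Computational_Algebra.Polynomial_Factorial"
begin

section \<open>Lucas polynomials\<close>

text \<open>
  The ring of integer polynomials in two variables \<open>s\<close>, \<open>t\<close> is \<^typ>\<open>int poly poly\<close>, that is,
  polynomials in \<open>t\<close> whose coefficients are integer polynomials in \<open>s\<close>: the coefficient of
  \<open>s\<^sup>i t\<^sup>j\<close> in \<open>p\<close> is \<open>coeff (coeff p j) i\<close>.
\<close>

definition var_s :: "int poly poly" where
  "var_s = [:[:0, 1:]:]"

definition var_t :: "int poly poly" where
  "var_t = [:0, 1:]"

fun lucas :: "nat \<Rightarrow> int poly poly" where
  "lucas 0 = 0"
| "lucas (Suc 0) = 1"
| "lucas (Suc (Suc m)) = var_s * lucas (Suc m) + var_t * lucas m"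

text \<open>
  Division in a field type is total with \<open>x / 0 = 0\<close>; the next two facts show that this convention
  plays no role for quotients by \<open>lucas m\<close> with \<open>m > 0\<close>.
\<close>

lemma lucas_eval_1_pos: "poly (poly (lucas (Suc m)) 1) 1 > 0"
proof -
  have "poly (poly (lucas m) 1) 1 \<ge> 0 \<and> poly (poly (lucas (Suc m)) 1) 1 > 0"
    by (induction m) (auto simp: var_s_def var_t_def)
  then show ?thesis by blast
qed

lemma lucas_nonzero: "m > 0 \<Longrightarrow> lucas m \<noteq> 0"
  using lucas_eval_1_pos[of "m - 1"] by fastforce

text \<open>The subset \<open>\<nat>[s,t]\<close> of the fraction field of \<open>\<int>[s,t]\<close>.\<close>

definition nat_polys :: "int poly poly fract set" where
  "nat_polys = {to_fract p | p. \<forall>i j. coeff (coeff p j) i \<ge> 0}"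


section \<open>Finite irreducible Coxeter groups and their degrees\<close>

text \<open>
  A finite irreducible Coxeter group is represented by its type in the classification.
\<close>

datatype coxeter_type =
    Cox_A nat | Cox_B nat | Cox_D nat
  | Cox_E6 | Cox_E7 | Cox_E8 | Cox_F4 | Cox_H3 | Cox_H4
  | Cox_I2 nat

text \<open>
  The bounds exclude the parameters that do not name an irreducible group (such as \<open>A\<^sub>0\<close>,
  \<open>D\<^sub>2 = I\<^sub>2(2) = A\<^sub>1 \<times> A\<^sub>1\<close>) and those that only rename another group in the list
  (\<open>B\<^sub>1 = A\<^sub>1\<close>, \<open>D\<^sub>3 = A\<^sub>3\<close>). The coincidences \<open>I\<^sub>2(3) = A\<^sub>2\<close> and \<open>I\<^sub>2(4) = B\<^sub>2\<close> are kept; the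
  degrees agree.
\<close>

fun finite_irreducible_coxeter :: "coxeter_type \<Rightarrow> bool" where
  "finite_irreducible_coxeter (Cox_A n) \<longleftrightarrow> n \<ge> 1"
| "finite_irreducible_coxeter (Cox_B n) \<longleftrightarrow> n \<ge> 2"
| "finite_irreducible_coxeter (Cox_D n) \<longleftrightarrow> n \<ge> 4"
| "finite_irreducible_coxeter (Cox_I2 m) \<longleftrightarrow> m \<ge> 3"
| "finite_irreducible_coxeter _ \<longleftrightarrow> True"

fun cox_rank :: "coxeter_type \<Rightarrow> nat" where
  "cox_rank (Cox_A n) = n"
| "cox_rank (Cox_B n) = n"
| "cox_rank (Cox_D n) = n"
| "cox_rank Cox_E6 = 6"
| "cox_rank Cox_E7 = 7"
| "cox_rank Cox_E8 = 8"
| "cox_rank Cox_F4 = 4"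
| "cox_rank Cox_H3 = 3"
| "cox_rank Cox_H4 = 4"
| "cox_rank (Cox_I2 m) = 2"

fun cox_degrees :: "coxeter_type \<Rightarrow> nat multiset" where
  "cox_degrees (Cox_A n) = mset_set {2..n + 1}"
| "cox_degrees (Cox_B n) = {#2 * i. i \<in># mset_set {1..n}#}"
| "cox_degrees (Cox_D n) = {#2 * i. i \<in># mset_set {1..n - 1}#} + {#n#}"
| "cox_degrees Cox_E6 = {#2, 5, 6, 8, 9, 12#}"
| "cox_degrees Cox_E7 = {#2, 6, 8, 10, 12, 14, 18#}"
| "cox_degrees Cox_E8 = {#2, 8, 12, 14, 18, 20, 24, 30#}"
| "cox_degrees Cox_F4 = {#2, 6, 8, 12#}"
| "cox_degrees Cox_H3 = {#2, 6, 10#}"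
| "cox_degrees Cox_H4 = {#2, 12, 20, 30#}"
| "cox_degrees (Cox_I2 m) = {#2, m#}"

lemma size_cox_degrees:
  "finite_irreducible_coxeter W \<Longrightarrow> size (cox_degrees W) = cox_rank W"
  by (cases W) auto

lemma cox_degrees_pos:
  "finite_irreducible_coxeter W \<Longrightarrow> d \<in># cox_degrees W \<Longrightarrow> d > 0"
  by (cases W) auto

text \<open>
  \<open>cox_degree W j\<close> is \<open>d\<^sub>j\<close>, for \<open>1 \<le> j \<le> cox_rank W\<close>, when the degrees are listed in weakly
  increasing order.
\<close>

definition cox_degree :: "coxeter_type \<Rightarrow> nat \<Rightarrow> nat" where
  "cox_degree W j = sorted_list_of_multiset (cox_degrees W) ! (j - 1)"


section \<open>The Lucas analogue of the Fuss--Catalan number\<close>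

definition lucas_cat :: "nat \<Rightarrow> coxeter_type \<Rightarrow> int poly poly fract" where
  "lucas_cat k W =
     (\<Prod>j = 1..cox_rank W.
        to_fract (lucas (cox_degree W j + k * cox_degree W (cox_rank W))) /
        to_fract (lucas (cox_degree W j)))"

end

theory Submission
  imports Defs "HOL-Computational_Algebra.Fundamental_Theorem_Algebra"
begin

text \<open>
  Write \<open>s = X + Y\<close> and \<open>t = - X Y\<close>. Then \<open>{m} = (X\<^sup>m - Y\<^sup>m) / (X - Y)\<close>, and pairing conjugate roots of
  unity factors \<open>{m}\<close> over the reals into the polynomials \<open>s\<^sup>2 + 4 cos\<^sup>2(\<pi> j / m) t\<close> with
  \<open>0 < 2 j < m\<close>, together with \<open>s\<close> if \<open>m\<close> is even. Collecting the fractions \<open>j / m\<close> by their reduced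
  denominators gives \<open>{m} = \<Prod>\<^bsub>d | m\<^esub> P\<^sub>d\<close>, where \<open>P\<^sub>1 = 1\<close> and every atom \<open>P\<^sub>d\<close> has non-negative
  coefficients. The quotient is therefore a product of atoms as soon as, for every \<open>d \<ge> 2\<close>, at least
  as many of the \<open>d\<^sub>j + k d\<^sub>n\<close> as of the \<open>d\<^sub>j\<close> are divisible by \<open>d\<close>, which is checked type by type.
  The quotient has integral coefficients because the lowest coefficient of \<open>{m}\<close> in \<open>t\<close> is the monic
  monomial \<open>s\<^sup>m\<^sup>-\<^sup>1\<close>.
\<close>

section \<open>Integral and non-negative bivariate real polynomials\<close>

lemma map_poly_mult_hom:
  fixes f :: "'a::comm_semiring_1 \<Rightarrow> 'b::comm_semiring_1"
  assumes "f 0 = 0" "\<And>x y. f (x + y) = f x + f y" "\<And>x y. f (x * y) = f x * f y"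
  shows "map_poly f (p * q) = map_poly f p * map_poly f q"
proof (rule poly_eqI)
  fix n
  have "f (sum g A) = (\<Sum>x\<in>A. f (g x))" for g and A :: "nat set"
    by (induction A rule: infinite_finite_induct) (auto simp: assms)
  then show "coeff (map_poly f (p * q)) n = coeff (map_poly f p * map_poly f q) n"
    by (simp add: coeff_map_poly coeff_mult assms)
qed

section \<open>Embedding into real polynomials and descent back to the integers\<close>

definition real_poly2 :: "int poly poly \<Rightarrow> real poly poly" where
  "real_poly2 = map_poly (map_poly real_of_int)"

lemma coeff_real_poly2 [simp]:
  "coeff (real_poly2 p) j = map_poly real_of_int (coeff p j)"
  by (simp add: real_poly2_def coeff_map_poly)

lemma real_poly2_add: "real_poly2 (p + q) = real_poly2 p + real_poly2 q"
  by (intro poly_eqI) (simp add: coeff_map_poly)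

lemma real_poly2_mult: "real_poly2 (p * q) = real_poly2 p * real_poly2 q"
  unfolding real_poly2_def
  by (intro map_poly_mult_hom poly_eqI) (simp_all add: coeff_map_poly map_poly_mult_hom)

lemma real_poly2_0 [simp]: "real_poly2 0 = 0"
  by (simp add: real_poly2_def)

lemma real_poly2_1 [simp]: "real_poly2 1 = 1"
  by (simp add: real_poly2_def map_poly_1')

lemma real_poly2_prod_mset:
  "real_poly2 (\<Prod>x\<in>#A. f x) = (\<Prod>x\<in>#A. real_poly2 (f x))"
  by (induction A) (simp_all add: real_poly2_mult)

lemma real_poly2_inj: "real_poly2 p = real_poly2 q \<Longrightarrow> p = q"
proof (intro poly_eqI)
  fix i j assume "real_poly2 p = real_poly2 q"
  then have "coeff (coeff (real_poly2 p) j) i = coeff (coeff (real_poly2 q) j) i" by simp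
  then show "coeff (coeff p j) i = coeff (coeff q j) i" by (simp add: coeff_map_poly)
qed

definition integral_poly :: "real poly \<Rightarrow> bool" where
  "integral_poly p \<longleftrightarrow> (\<forall>i. coeff p i \<in> \<int>)"

lemma integral_poly_diff: "integral_poly p \<Longrightarrow> integral_poly q \<Longrightarrow> integral_poly (p - q)"
  by (auto simp: integral_poly_def)

lemma integral_poly_mult: "integral_poly p \<Longrightarrow> integral_poly q \<Longrightarrow> integral_poly (p * q)"
  by (auto simp: integral_poly_def coeff_mult intro!: Ints_sum Ints_mult)

lemma integral_poly_sum: "(\<And>x. x \<in> A \<Longrightarrow> integral_poly (f x)) \<Longrightarrow> integral_poly (sum f A)"
  by (auto simp: integral_poly_def coeff_sum intro!: Ints_sum)

lemma integral_poly_of_int [simp]: "integral_poly (map_poly real_of_int p)"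
  by (auto simp: integral_poly_def coeff_map_poly)

lemma integral_poly_monom_multD:
  assumes "integral_poly (monom 1 n * p)"
  shows "integral_poly p"
  unfolding integral_poly_def
proof
  fix i
  have "coeff (monom 1 n * p) (n + i) \<in> \<int>" using assms by (simp add: integral_poly_def)
  then show "coeff p i \<in> \<int>" by (simp add: coeff_monom_mult)
qed

lemma integral_poly2_lift:
  assumes "\<And>j. integral_poly (coeff q j)"
  obtains q' where "q = real_poly2 q'"
proof
  show "q = real_poly2 (map_poly (map_poly floor) q)"
  proof (intro poly_eqI)
    fix i j
    have "coeff (coeff q j) i \<in> \<int>" using assms by (simp add: integral_poly_def)
    then have *: "real_of_int \<lfloor>coeff (coeff q j) i\<rfloor> = coeff (coeff q j) i"
      by (metis Ints_cases floor_of_int)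
    show "coeff (coeff q j) i = coeff (coeff (real_poly2 (map_poly (map_poly floor) q)) j) i"
      by (simp add: coeff_map_poly *)
  qed
qed

text \<open>Comparing coefficients of t^j gives b_0 q_j = a_j - (sum over i < j of q_i b_(j-i)). As
  b_0 is a monic monomial in s, multiplying by it only shifts coefficients, so q_j inherits
  integrality from the earlier q_i.\<close>

lemma integral_quotient:
  assumes eq: "real_poly2 a = q * real_poly2 b" and b0: "coeff b 0 = monom 1 n"
  obtains q' where "q = real_poly2 q'" "a = q' * b"
proof -
  have "integral_poly (coeff q j)" for j
  proof (induction j rule: less_induct)
    case (less j)
    let ?b = "\<lambda>i. map_poly real_of_int (coeff b i)"
    have "map_poly real_of_int (coeff a j) = (\<Sum>i\<le>j. coeff q i * ?b (j - i))"
      using arg_cong[OF eq, of "\<lambda>p. coeff p j"] by (simp add: coeff_mult)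
    also have "\<dots> = (\<Sum>i<j. coeff q i * ?b (j - i)) + coeff q j * ?b 0"
      by (simp add: lessThan_Suc_atMost [symmetric])
    finally have "monom 1 n * coeff q j =
        map_poly real_of_int (coeff a j) - (\<Sum>i<j. coeff q i * ?b (j - i))"
      by (simp add: b0 map_poly_monom algebra_simps)
    moreover have "integral_poly \<dots>"
      by (intro integral_poly_diff integral_poly_sum integral_poly_mult less) auto
    ultimately show ?case by (metis integral_poly_monom_multD)
  qed
  then obtain q' where q': "q = real_poly2 q'" by (rule integral_poly2_lift)
  moreover have "a = q' * b"
    using eq unfolding q' real_poly2_mult [symmetric] by (rule real_poly2_inj)
  ultimately show ?thesis by (rule that)
qed

definition nonneg_poly2 :: "real poly poly \<Rightarrow> bool" where
  "nonneg_poly2 p \<longleftrightarrow> (\<forall>i j. coeff (coeff p j) i \<ge> 0)"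

lemma nonneg_poly2_mult: "nonneg_poly2 p \<Longrightarrow> nonneg_poly2 q \<Longrightarrow> nonneg_poly2 (p * q)"
  by (auto simp: nonneg_poly2_def coeff_mult coeff_sum intro!: sum_nonneg)

lemma nonneg_poly2_1 [simp]: "nonneg_poly2 1"
  by (auto simp: nonneg_poly2_def coeff_1)

lemma nonneg_poly2_prod: "(\<And>x. x \<in> A \<Longrightarrow> nonneg_poly2 (f x)) \<Longrightarrow> nonneg_poly2 (prod f A)"
  by (induction A rule: infinite_finite_induct) (auto intro!: nonneg_poly2_mult)

lemma nonneg_poly2_power: "nonneg_poly2 p \<Longrightarrow> nonneg_poly2 (p ^ n)"
  by (induction n) (auto intro!: nonneg_poly2_mult)

text \<open>The outer variable t takes values in \<open>real poly\<close>, so the number t is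
  inserted there as a constant polynomial.\<close>

definition eval2 :: "real \<Rightarrow> real \<Rightarrow> real poly poly \<Rightarrow> real" where
  "eval2 s t p = poly (poly p [:t:]) s"

lemma eval2_mult: "eval2 s t (p * q) = eval2 s t p * eval2 s t q"
  by (simp add: eval2_def)

lemma eval2_prod: "eval2 s t (prod f A) = (\<Prod>x\<in>A. eval2 s t (f x))"
  by (simp add: eval2_def poly_prod)

lemma poly_eqI_infinite:
  fixes p q :: "'a::idom poly"
  assumes "infinite A" "\<And>x. x \<in> A \<Longrightarrow> poly p x = poly q x"
  shows "p = q"
proof (rule ccontr)
  assume "p \<noteq> q"
  then have "finite {x. poly (p - q) x = 0}" by (intro poly_roots_finite) auto
  moreover have "A \<subseteq> {x. poly (p - q) x = 0}" using assms by auto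
  ultimately show False using assms(1) finite_subset by blast
qed

text \<open>The positive reals are infinite, so they suffice for the outer and then for the inner
  variable. Positivity is allowed as an assumption because it makes s^2 + 4t positive, so that X and
  Y can be taken real and distinct.\<close>

lemma eval2_eqI:
  assumes "\<And>s t. s > 0 \<Longrightarrow> t > 0 \<Longrightarrow> eval2 s t p = eval2 s t q"
  shows "p = q"
proof (rule poly_eqI_infinite)
  have "inj (\<lambda>t::real. [:t:])" by (auto intro: injI)
  then show "infinite ((\<lambda>t::real. [:t:]) ` {0<..})"
    by (metis finite_imageD infinite_Ioi inj_on_subset subset_UNIV)
next
  fix x :: "real poly" assume "x \<in> (\<lambda>t::real. [:t:]) ` {0<..}"
  then obtain t :: real where t: "t > 0" "x = [:t:]" by auto
  show "poly p x = poly q x"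
  proof (rule poly_eqI_infinite)
    show "infinite {0::real<..}" by (rule infinite_Ioi)
    show "poly (poly p x) s = poly (poly q x) s" if "s \<in> {0<..}" for s
      using assms[of s t] that t by (auto simp: eval2_def)
  qed
qed

section \<open>Factorisation of Lucas polynomials\<close>

text \<open>Homogenised form of the splitting of z^n - 1 over the n-th roots of unity, obtained at z
  = x / y.\<close>

lemma diff_power_complex_factor:
  fixes x y :: complex
  assumes "n > 0"
  shows "x ^ n - y ^ n = (\<Prod>j<n. x - cis (2 * pi * real j / real n) * y)"
proof (cases "y = 0")
  case True
  then show ?thesis using assms by simp
next
  case False
  define p :: "complex poly" where "p = monom 1 n - 1"
  have p_eval: "poly p z = z ^ n - 1" for z by (simp add: p_def poly_monom)
  have "degree p = n"
    unfolding p_def diff_conv_add_uminus using assms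
    by (subst degree_add_eq_left) (simp_all add: degree_monom_eq)
  moreover have "coeff p n = 1" using assms by (simp add: p_def)
  ultimately have lead: "lead_coeff p = 1" by simp
  have pd: "pderiv p = monom (of_nat n) (n - 1)"
    by (simp add: p_def pderiv_diff pderiv_monom)
  \<comment> \<open>The derivative n z^(n-1) can vanish only at 0, where z^n - 1 does not, so every
    root is simple.\<close>
  have "rsquarefree p"
    unfolding rsquarefree_roots using assms by (auto simp: p_eval pd poly_monom power_0_left)
  then have "p = (\<Prod>z | z ^ n = 1. [:- z, 1:])"
    using complex_poly_decompose_rsquarefree[of p] lead by (simp add: p_eval)
  also have "\<dots> = (\<Prod>j<n. [:- cis (2 * pi * real j / real n), 1:])"
    by (rule prod.reindex_bij_betw [symmetric, OF bij_betw_roots_unity[OF assms]])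
  finally have "(x / y) ^ n - 1 = (\<Prod>j<n. x / y - cis (2 * pi * real j / real n))"
    unfolding p_eval [symmetric] by (simp add: poly_prod)
  then have "y ^ n * ((x / y) ^ n - 1) = (\<Prod>j<n. y) * (\<Prod>j<n. x / y - cis (2 * pi * real j / real n))"
    by simp
  also have "\<dots> = (\<Prod>j<n. x - cis (2 * pi * real j / real n) * y)"
    unfolding prod.distrib [symmetric] using False by (intro prod.cong) (auto simp: field_simps)
  also have "y ^ n * ((x / y) ^ n - 1) = x ^ n - y ^ n"
    using False by (simp add: power_divide right_diff_distrib)
  finally show ?thesis .
qed

lemma diff_power_real_factor:
  fixes x y :: real
  assumes "n > 0"
  shows "x ^ n - y ^ n = (x - y) * (if even n then x + y else 1) *
    (\<Prod>j | 0 < j \<and> 2 * j < n. x\<^sup>2 - 2 * cos (2 * pi * real j / real n) * x * y + y\<^sup>2)"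
proof -
  define f where "f j = complex_of_real x - cis (2 * pi * real j / real n) * complex_of_real y" for j
  \<comment> \<open>The root 1 (j = 0) gives x - y. The involution sending j to n - j swaps
    \<open>L\<close> and \<open>U\<close> and pairs conjugate roots; \<open>M\<close> is its fixed
    point n / 2, the root -1, present only for even n.\<close>
  define L where "L = {j. 0 < j \<and> 2 * j < n}"
  define U where "U = {j. n < 2 * j \<and> j < n}"
  define M where "M = {j. 2 * j = n}"
  have fin: "finite L" "finite U" "finite M"
    by (rule finite_subset[of _ "{..n}"]; auto simp: L_def U_def M_def)+
  have split: "{..<n} = insert 0 (M \<union> (L \<union> U))"
    using assms by (auto simp: L_def U_def M_def)
  have "(\<Prod>j<n. f j) = f 0 * prod f (M \<union> (L \<union> U))"
    unfolding split using fin assms by (subst prod.insert) (auto simp: L_def U_def M_def)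
  also have "prod f (M \<union> (L \<union> U)) = prod f M * prod f (L \<union> U)"
    using fin by (intro prod.union_disjoint) (auto simp: L_def U_def M_def)
  also have "prod f (L \<union> U) = prod f L * prod f U"
    using fin by (intro prod.union_disjoint) (auto simp: L_def U_def M_def)
  also have "prod f U = (\<Prod>j\<in>L. f (n - j))"
    by (rule prod.reindex_bij_witness[of _ "\<lambda>j. n - j" "\<lambda>j. n - j"]) (auto simp: L_def U_def)
  also have "prod f L * \<dots> = (\<Prod>j\<in>L. f j * f (n - j))"
    by (simp add: prod.distrib)
  also have "\<dots> = (\<Prod>j\<in>L. of_real (x\<^sup>2 - 2 * cos (2 * pi * real j / real n) * x * y + y\<^sup>2))"
  proof (rule prod.cong)
    fix j assume "j \<in> L"
    define a where "a = 2 * pi * real j / real n"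
    have "2 * pi * real (n - j) / real n = 2 * pi - a"
      using \<open>j \<in> L\<close> assms by (simp add: L_def a_def of_nat_diff field_simps)
    then have "f j * f (n - j) =
        (of_real x - cis a * of_real y) * (of_real x - cis (2 * pi - a) * of_real y)"
      by (simp add: f_def a_def)
    also have "cis (2 * pi - a) = cis (- a)"
      by (simp add: cis.ctr)
    \<comment> \<open>Leaving cos^2 + sin^2 unevaluated turns the comparison of real and imaginary
      parts into a pure ring identity.\<close>
    also have "(of_real x - cis a * of_real y) * (of_real x - cis (- a) * of_real y) =
        of_real (x\<^sup>2 - 2 * cos a * x * y + ((cos a)\<^sup>2 + (sin a)\<^sup>2) * y\<^sup>2)"
      by (simp only: complex_eq_iff) (simp add: power2_eq_square algebra_simps
          del: sin_cos_squared_add sin_cos_squared_add2 sin_cos_squared_add3)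
    finally show "f j * f (n - j) = of_real (x\<^sup>2 - 2 * cos (2 * pi * real j / real n) * x * y + y\<^sup>2)"
      by (simp add: a_def)
  qed auto
  also have "\<dots> = of_real (\<Prod>j\<in>L. x\<^sup>2 - 2 * cos (2 * pi * real j / real n) * x * y + y\<^sup>2)"
    by simp
  also have "prod f M = of_real (if even n then x + y else 1)"
  proof (cases "even n")
    case True
    then obtain m where m: "n = 2 * m" by auto
    then have "M = {m}" by (auto simp: M_def)
    then show ?thesis using m assms by (simp add: f_def)
  next
    case False
    then have "M = {}" by (auto simp: M_def)
    then show ?thesis using False by simp
  qed
  also have "f 0 = of_real (x - y)" by (simp add: f_def)
  finally have "complex_of_real (x ^ n - y ^ n) = of_real ((x - y) * (if even n then x + y else 1) *
      (\<Prod>j\<in>L. x\<^sup>2 - 2 * cos (2 * pi * real j / real n) * x * y + y\<^sup>2))"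
    using diff_power_complex_factor[OF assms, of "of_real x" "of_real y"]
    by (simp add: f_def mult.assoc)
  then show ?thesis unfolding of_real_eq_iff L_def .
qed

text \<open>Binet's formula without division: x and y are the roots of z^2 = s z + t, so both sides
  satisfy the same recurrence.\<close>

lemma eval2_lucas:
  "(x - y) * eval2 (x + y) (- (x * y)) (real_poly2 (lucas m)) = x ^ m - y ^ m"
proof (induction m rule: lucas.induct)
  case (3 m)
  have s: "real_poly2 var_s = [:[:0, 1:]:]" and t: "real_poly2 var_t = [:0, 1:]"
    by (simp_all add: var_s_def var_t_def real_poly2_def map_poly_pCons)
  let ?e = "\<lambda>m. eval2 (x + y) (- (x * y)) (real_poly2 (lucas m))"
  have "(x - y) * ?e (Suc (Suc m)) =
      (x + y) * ((x - y) * ?e (Suc m)) - x * y * ((x - y) * ?e m)"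
    by (simp add: real_poly2_add real_poly2_mult s t eval2_def algebra_simps)
  also have "\<dots> = x ^ Suc (Suc m) - y ^ Suc (Suc m)"
    unfolding 3 by (simp add: algebra_simps)
  finally show ?case .
qed (simp_all add: eval2_def)

text \<open>At s = x + y, t = -xy this is x^2 - 2 cos(2 pi r) xy + y^2, the factor of a conjugate
  pair. Indexing by the number r makes equal fractions give the same factor.\<close>

definition lucas_factor :: "real \<Rightarrow> real poly poly" where
  "lucas_factor r = [:[:0, 0, 1:], [:4 * (cos (pi * r))\<^sup>2:]:]"

text \<open>For d at least 2 this is the homogenised d-th cyclotomic polynomial written in s and t:
  one factor per conjugate pair of primitive d-th roots of unity. For d = 2 the only such root is
  -1, which contributes s = X + Y.\<close>

definition lucas_atom :: "nat \<Rightarrow> real poly poly" where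
  "lucas_atom d = (if d = 2 then [:[:0, 1:]:] else 1) *
     (\<Prod>a | 0 < a \<and> 2 * a < d \<and> coprime a d. lucas_factor (real a / real d))"

lemma nonneg_poly2_lucas_atom: "nonneg_poly2 (lucas_atom d)"
  unfolding lucas_atom_def
  by (intro nonneg_poly2_mult nonneg_poly2_prod)
     (auto simp: nonneg_poly2_def lucas_factor_def coeff_pCons split: nat.splits)

lemma lucas_factorisation:
  assumes "m > 0"
  shows "real_poly2 (lucas m) = (if even m then [:[:0, 1:]:] else 1) *
    (\<Prod>j | 0 < j \<and> 2 * j < m. lucas_factor (real j / real m))"
proof (rule eval2_eqI)
  fix s t :: real assume st: "s > 0" "t > 0"
  \<comment> \<open>The square root of the discriminant of z^2 - s z - t. It equals x - y, and being
    positive it can be cancelled below.\<close>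
  define D where "D = sqrt (s\<^sup>2 + 4 * t)"
  have D: "D > 0" "D\<^sup>2 = s\<^sup>2 + 4 * t" using st by (auto simp: D_def add_pos_pos)
  define x where "x = (s + D) / 2"
  define y where "y = (s - D) / 2"
  have xy: "x + y = s" "- (x * y) = t" "x - y > 0"
    using D by (auto simp: x_def y_def field_simps power2_eq_square)
  have fac: "eval2 s t (lucas_factor (real j / real m)) =
      x\<^sup>2 - 2 * cos (2 * pi * real j / real m) * x * y + y\<^sup>2" for j
  proof -
    have double: "2 * pi * real j / real m = 2 * (pi * (real j / real m))" by simp
    show ?thesis
      unfolding double cos_double_cos xy(1,2) [symmetric] eval2_def lucas_factor_def
      by (simp add: power2_eq_square algebra_simps)
  qed
  have "(x - y) * eval2 s t (real_poly2 (lucas m)) = x ^ m - y ^ m"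
    using eval2_lucas[of x y m] by (simp only: xy)
  also have "\<dots> = (x - y) * ((if even m then s else 1) *
      (\<Prod>j | 0 < j \<and> 2 * j < m. eval2 s t (lucas_factor (real j / real m))))"
    unfolding diff_power_real_factor[OF assms] fac xy by simp
  finally have "eval2 s t (real_poly2 (lucas m)) = (if even m then s else 1) *
      (\<Prod>j | 0 < j \<and> 2 * j < m. eval2 s t (lucas_factor (real j / real m)))"
    using xy by simp
  then show "eval2 s t (real_poly2 (lucas m)) = eval2 s t ((if even m then [:[:0, 1:]:] else 1) *
      (\<Prod>j | 0 < j \<and> 2 * j < m. lucas_factor (real j / real m)))"
    by (simp add: eval2_mult eval2_prod) (simp add: eval2_def)
qed

text \<open>Each fraction j / m strictly between 0 and 1/2 has a unique reduced form a / d with d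
  dividing m. The reindexing reduces fractions in one direction and expands them to denominator m in
  the other.\<close>

lemma lucas_eq_prod_atoms:
  assumes "m > 0"
  shows "real_poly2 (lucas m) = (\<Prod>d | d dvd m. lucas_atom d)"
proof -
  let ?A = "\<lambda>d. {a::nat. 0 < a \<and> 2 * a < d \<and> coprime a d}"
  have fin: "finite {d. d dvd m}" using assms by simp
  have finA: "finite (?A d)" for d by (rule finite_subset[of _ "{..d}"]) auto
  have "(\<Prod>d | d dvd m. \<Prod>a\<in>?A d. lucas_factor (real a / real d)) =
      (\<Prod>(d, a)\<in>(SIGMA d:{d. d dvd m}. ?A d). lucas_factor (real a / real d))"
    using fin finA by (intro prod.Sigma) auto
  also have "\<dots> = (\<Prod>j | 0 < j \<and> 2 * j < m. lucas_factor (real j / real m))"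
  proof (rule prod.reindex_bij_witness[of _ "\<lambda>j. (m div gcd j m, j div gcd j m)"
        "\<lambda>(d, a). a * (m div d)"], goal_cases)
    case (1 p)
    then obtain d a c where p: "p = (d, a)" "m = d * c" "0 < a" "2 * a < d" "coprime a d"
      by (auto elim!: dvdE)
    then have "c > 0" "d > 0" using assms by auto
    moreover have "gcd (a * c) (d * c) = c"
      using p by (metis gcd_mult_distrib_nat mult.commute mult.right_neutral coprime_imp_gcd_eq_1)
    ultimately show ?case using p by simp
  next
    case (2 p)
    then obtain d a c where p: "p = (d, a)" "m = d * c" "0 < a" "2 * a < d" "coprime a d"
      by (auto elim!: dvdE)
    then have "c > 0" "d > 0" using assms by auto
    then show ?case using p by simp
  next
    case (3 j)
    define g where "g = gcd j m"
    have "g > 0" using assms by (simp add: g_def)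
    moreover obtain a d where "j = a * g" "m = d * g" "coprime a d"
      using gcd_coprime_exists[of j m] \<open>g > 0\<close> unfolding g_def by auto
    ultimately show ?case using 3 assms unfolding g_def [symmetric] by auto
  next
    case (4 j)
    define g where "g = gcd j m"
    have "g > 0" using assms by (simp add: g_def)
    moreover obtain a d where "j = a * g" "m = d * g" "coprime a d"
      using gcd_coprime_exists[of j m] \<open>g > 0\<close> unfolding g_def by auto
    ultimately show ?case using 4 assms unfolding g_def [symmetric] by auto
  next
    case (5 p)
    then obtain d a c where p: "p = (d, a)" "m = d * c" "0 < a" "2 * a < d" "coprime a d"
      by (auto elim!: dvdE)
    then have "c > 0" "d > 0" using assms by auto
    then show ?case using p by simp
  qed
  \<comment> \<open>The extra factor s comes from the atom at d = 2, which occurs exactly when m is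
    even.\<close>
  finally show ?thesis
    unfolding lucas_factorisation[OF assms] lucas_atom_def prod.distrib using fin
    by (simp add: prod.delta)
qed

section \<open>Multiplicities of atoms and quotients of products\<close>

lemma lucas_atom_1 [simp]: "lucas_atom (Suc 0) = 1"
proof -
  have "{a::nat. 0 < a \<and> 2 * a < Suc 0 \<and> coprime a (Suc 0)} = {}" by auto
  then show ?thesis by (simp only: lucas_atom_def) simp
qed

text \<open>The bound \<open>N\<close> gives numerator and denominator a common index range, so that
  their exponents can be compared atom by atom.\<close>

lemma prod_lucas_eq_prod_atoms:
  assumes "\<And>x. x \<in># A \<Longrightarrow> 0 < x \<and> x \<le> N"
  shows "(\<Prod>x\<in>#A. real_poly2 (lucas x)) =
    (\<Prod>d=1..N. lucas_atom d ^ size (filter_mset (\<lambda>x. d dvd x) A))"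
  using assms
proof (induction A)
  case (add x A)
  have x: "0 < x" "x \<le> N" using add.prems[of x] by auto
  have "real_poly2 (lucas x) = (\<Prod>d | d \<in> {1..N} \<and> d dvd x. lucas_atom d)"
    unfolding lucas_eq_prod_atoms[OF x(1)] using x
    by (intro prod.cong) (auto dest: dvd_imp_le intro!: Nat.gr0I)
  also have "\<dots> = (\<Prod>d=1..N. if d dvd x then lucas_atom d else 1)"
    by (rule prod.inter_filter) simp
  finally have "(\<Prod>x\<in>#add_mset x A. real_poly2 (lucas x)) =
      (\<Prod>d=1..N. (if d dvd x then lucas_atom d else 1) *
        lucas_atom d ^ size (filter_mset (\<lambda>x. d dvd x) A))"
    using add by (simp add: prod.distrib)
  also have "\<dots> = (\<Prod>d=1..N. lucas_atom d ^ size (filter_mset (\<lambda>y. d dvd y) (add_mset x A)))"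
    by (intro prod.cong) auto
  finally show ?case .
qed simp

text \<open>At t = 0 the recurrence becomes multiplication by s. This supplies the monic monomial
  required by \<open>integral_quotient\<close>.\<close>

lemma coeff_0_lucas: "coeff (lucas (Suc m)) 0 = monom 1 m"
proof (induction m)
  case (Suc m)
  have "coeff (lucas (Suc (Suc m))) 0 = [:0, 1:] * coeff (lucas (Suc m)) 0"
    by (simp add: var_s_def var_t_def coeff_mult_0)
  then show ?case using Suc by (simp add: monom_Suc)
qed (simp add: monom_0 one_pCons)

lemma coeff_0_prod_lucas:
  assumes "\<And>x. x \<in># A \<Longrightarrow> 0 < x"
  shows "\<exists>n. coeff (\<Prod>x\<in>#A. lucas x) 0 = monom 1 n"
  using assms
proof (induction A)
  case empty
  show ?case by (intro exI[of _ 0]) (simp add: monom_0 one_pCons)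
next
  case (add x A)
  then obtain n where "coeff (\<Prod>x\<in>#A. lucas x) 0 = monom 1 n" by auto
  moreover obtain m where "x = Suc m" using add.prems[of x] by (cases x) auto
  ultimately show ?case by (auto simp: coeff_mult_0 coeff_0_lucas mult_monom)
qed

lemma lucas_quotient_nat_poly:
  assumes pos: "\<And>x. x \<in># A \<Longrightarrow> 0 < x" "\<And>x. x \<in># B \<Longrightarrow> 0 < x"
    and le: "\<And>d. d \<ge> 2 \<Longrightarrow>
      size (filter_mset (\<lambda>x. d dvd x) B) \<le> size (filter_mset (\<lambda>x. d dvd x) A)"
  obtains q where "(\<Prod>x\<in>#A. lucas x) = q * (\<Prod>x\<in>#B. lucas x)"
    and "\<And>i j. coeff (coeff q j) i \<ge> 0"
proof -
  define N where "N = Max (set_mset (A + B))"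
  let ?a = "\<lambda>d. size (filter_mset (\<lambda>x. d dvd x) A)"
  let ?b = "\<lambda>d. size (filter_mset (\<lambda>x. d dvd x) B)"
  define Q where "Q = (\<Prod>d=1..N. lucas_atom d ^ (?a d - ?b d))"
  \<comment> \<open>For d at least 2, \<open>le\<close> makes the truncated subtraction exact; for d
    = 1 the atom is 1, whatever the exponents.\<close>
  have "lucas_atom d ^ ?a d = lucas_atom d ^ (?a d - ?b d) * lucas_atom d ^ ?b d"
    if "d \<in> {1..N}" for d
    using that le[of d] by (cases "d = 1") (simp_all add: power_add [symmetric])
  then have eq: "real_poly2 (\<Prod>x\<in>#A. lucas x) = Q * real_poly2 (\<Prod>x\<in>#B. lucas x)"
    unfolding real_poly2_prod_mset Q_def using pos
    by (subst (1 2) prod_lucas_eq_prod_atoms[where N = N])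
       (auto simp: N_def prod.distrib [symmetric])
  obtain n where n: "coeff (\<Prod>x\<in>#B. lucas x) 0 = monom 1 n"
    using coeff_0_prod_lucas pos(2) by blast
  obtain q where q: "Q = real_poly2 q" "(\<Prod>x\<in>#A. lucas x) = q * (\<Prod>x\<in>#B. lucas x)"
    using integral_quotient[OF eq n] by blast
  have "nonneg_poly2 Q"
    unfolding Q_def by (intro nonneg_poly2_prod nonneg_poly2_power nonneg_poly2_lucas_atom)
  then have "coeff (coeff q j) i \<ge> 0" for i j
    by (simp add: nonneg_poly2_def q(1) coeff_map_poly)
  with q(2) show ?thesis by (rule that)
qed

section \<open>Divisibility among the degrees\<close>

lemma card_multiples_shift:
  fixes d a n :: nat
  assumes "d > 0"
  shows "card {i \<in> {1..n}. d dvd a + i} = (a + n) div d - a div d"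
proof -
  \<comment> \<open>The additive form keeps truncated subtraction out of the induction.\<close>
  have "card {i \<in> {1..n}. d dvd a + i} + a div d = (a + n) div d"
  proof (induction n)
    case (Suc n)
    have "{i \<in> {1..Suc n}. d dvd a + i} =
        (if d dvd a + Suc n then insert (Suc n) else id) {i \<in> {1..n}. d dvd a + i}"
      by (auto simp: le_Suc_eq)
    then have "card {i \<in> {1..Suc n}. d dvd a + i} =
        card {i \<in> {1..n}. d dvd a + i} + (if d dvd a + Suc n then 1 else 0)"
      by simp
    then show ?case using Suc assms by (simp add: div_Suc dvd_eq_mod_eq_0)
  qed simp
  then show ?thesis by simp
qed

lemma card_multiples_shift_ge:
  fixes d a n :: nat
  assumes "d > 0"
  shows "n div d \<le> card {i \<in> {1..n}. d dvd a + i}"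
  unfolding card_multiples_shift[OF assms] by (simp add: div_add1_eq[of a n])

text \<open>A window starting at a multiple of d holds one multiple more than n div d unless d
  divides n: the residues d - 1 of a and at least 1 of n produce a carry.\<close>

lemma card_multiples_shift_gt:
  fixes d a n :: nat
  assumes "d > 0" "\<not> d dvd n" "d dvd a + 1"
  shows "n div d < card {i \<in> {1..n}. d dvd a + i}"
proof -
  have "a mod d = d - 1"
    using assms by (metis Suc_eq_plus1 diff_Suc_1 dvd_imp_mod_0 mod_Suc nat.distinct(1))
  moreover have "n mod d \<ge> 1" using assms by (simp add: dvd_eq_mod_eq_0)
  ultimately have "a mod d + n mod d \<ge> d" using assms by simp
  then have "(a mod d + n mod d) div d \<ge> 1" using assms by (simp add: div_greater_zero_iff Suc_le_eq)
  then show ?thesis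
    unfolding card_multiples_shift[OF assms(1)] by (simp add: div_add1_eq[of a n])
qed

text \<open>The witness is d / gcd(d, 2). It turns divisibility of the even degrees 2i into
  divisibility within an interval.\<close>

lemma dvd_double_iff:
  fixes d :: nat
  assumes "d > 0"
  obtains d' where "d' > 0" "d' dvd d" "\<And>x. d dvd 2 * x \<longleftrightarrow> d' dvd x"
proof (cases "even d")
  case True
  then show ?thesis using that[of "d div 2"] assms by (auto elim!: evenE)
next
  case False
  then have "coprime d 2" by simp
  then show ?thesis using that[of d] assms by (simp add: coprime_dvd_mult_right_iff)
qed

section \<open>Comparison of divisibility counts, type by type\<close>

lemma size_filter_image_mset_set:
  "finite S \<Longrightarrow> size (filter_mset P (image_mset f (mset_set S))) = card {x \<in> S. P (f x)}"
  by (simp add: filter_mset_image_mset filter_mset_mset_set)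

text \<open>The counting condition of \<open>lucas_quotient_nat_poly\<close> for the degrees
  \<open>D\<close> and their shifts by \<open>k * h\<close>; \<open>h\<close> will be the largest
  degree.\<close>

definition divisibility_dominated :: "nat \<Rightarrow> nat \<Rightarrow> nat multiset \<Rightarrow> bool" where
  "divisibility_dominated k h D \<longleftrightarrow> (\<forall>d\<ge>2.
     size (filter_mset (\<lambda>x. d dvd x) D) \<le> size (filter_mset (\<lambda>x. d dvd x + k * h) D))"

text \<open>The degrees are the window 1..n+1 without 1. Omitting 1 costs the shifted count a
  multiple only if d divides k(n+1) + 1; then d does not divide n + 1, and the full shifted window
  has one multiple to spare.\<close>

lemma divisibility_dominated_A:
  "divisibility_dominated k (n + 1) (cox_degrees (Cox_A n))"
  unfolding divisibility_dominated_def
proof (intro allI impI)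
  fix d :: nat assume d: "d \<ge> 2"
  let ?c = "\<lambda>a. card {i \<in> {2..n + 1}. d dvd a + i}"
  have c: "card {i \<in> {1..n + 1}. d dvd a + i} = ?c a + (if d dvd a + 1 then 1 else 0)" for a
  proof -
    have "{i \<in> {1..n + 1}. d dvd a + i} =
        (if d dvd a + 1 then insert 1 else id) {i \<in> {2..n + 1}. d dvd a + i}"
      by (auto simp: numeral_2_eq_2 le_eq_less_or_eq)
    then show ?thesis by simp
  qed
  have "?c 0 = (n + 1) div d"
    using c[of 0] card_multiples_shift[of d "n + 1" 0] d by simp
  also have "\<dots> \<le> ?c (k * (n + 1))"
  proof (cases "d dvd k * (n + 1) + 1")
    case True
    have "\<not> d dvd n + 1"
    proof
      assume "d dvd n + 1"
      then have "d dvd 1" using True by (metis dvd_add_right_iff dvd_mult)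
      then show False using d by simp
    qed
    then show ?thesis
      using c[of "k * (n + 1)"] card_multiples_shift_gt[of d "n + 1" "k * (n + 1)"] True d by simp
  next
    case False
    then show ?thesis
      using c[of "k * (n + 1)"] card_multiples_shift_ge[of d "n + 1" "k * (n + 1)"] d by simp
  qed
  finally show "size (filter_mset (\<lambda>x. d dvd x) (cox_degrees (Cox_A n))) \<le>
      size (filter_mset (\<lambda>x. d dvd x + k * (n + 1)) (cox_degrees (Cox_A n)))"
    by (simp add: filter_mset_mset_set add.commute)
qed

lemma divisibility_dominated_B:
  "divisibility_dominated k (2 * n) (cox_degrees (Cox_B n))"
  unfolding divisibility_dominated_def
proof (intro allI impI)
  fix d :: nat assume "d \<ge> 2"
  then obtain e where e: "e > 0" "\<And>x. d dvd 2 * x \<longleftrightarrow> e dvd x"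
    using dvd_double_iff[of d] by (metis less_le_trans pos2)
  have "d dvd 2 * i + k * (2 * n) \<longleftrightarrow> e dvd k * n + i" for i
    using e(2)[of "k * n + i"] by (simp add: algebra_simps)
  then show "size (filter_mset (\<lambda>x. d dvd x) (cox_degrees (Cox_B n))) \<le>
      size (filter_mset (\<lambda>x. d dvd x + k * (2 * n)) (cox_degrees (Cox_B n)))"
    using card_multiples_shift_ge[OF e(1), of n "k * n"] card_multiples_shift[OF e(1), of n 0]
    by (simp add: size_filter_image_mset_set e(2))
qed

text \<open>With rank n + 1 the largest degree is 2n. The critical case is that the degree n + 1
  loses its divisibility by d under the shift; the even degrees then gain a multiple to make up for
  it.\<close>

lemma divisibility_dominated_D:
  "divisibility_dominated k (2 * n) (cox_degrees (Cox_D (Suc n)))"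
  unfolding divisibility_dominated_def
proof (intro allI impI)
  fix d :: nat assume "d \<ge> 2"
  then obtain e where e: "e > 0" "e dvd d" "\<And>x. d dvd 2 * x \<longleftrightarrow> e dvd x"
    using dvd_double_iff[of d] by (metis less_le_trans pos2)
  let ?a = "k * n"
  have iff: "d dvd 2 * i + k * (2 * n) \<longleftrightarrow> e dvd ?a + i" for i
    using e(3)[of "?a + i"] by (simp add: algebra_simps)
  have "n div e + (if d dvd Suc n then 1 else 0) \<le>
      card {i \<in> {1..n}. e dvd ?a + i} + (if d dvd Suc n + k * (2 * n) then 1 else 0)"
  proof (cases "d dvd Suc n \<and> \<not> d dvd Suc n + k * (2 * n)")
    case True
    then have "\<not> d dvd 2 * ?a"
      by (metis dvd_add_right_iff mult.left_commute)
    then have "\<not> e dvd ?a" by (simp add: e(3))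
    moreover obtain c where c: "Suc n = e * c" using True e(2) by (meson dvdE dvd_trans)
    ultimately obtain b where b: "c = Suc b" "?a mod e = Suc (?a mod e - 1)"
      by (cases c) (auto simp: dvd_eq_mod_eq_0)
    \<comment> \<open>Since kn has nonzero residue modulo e, lowering kn + (n+1) by one crosses no
      multiple of e. The shifted window thus has c multiples, against c - 1 in 1..n.\<close>
    have "?a + n = e * (?a div e + c) + (?a mod e - 1)"
    proof -
      have "?a + Suc n = e * (?a div e) + ?a mod e + e * c"
        using c by simp
      then show ?thesis using b(2) by (simp add: distrib_left)
    qed
    moreover have "?a mod e - 1 < e" using e(1) by (meson less_imp_diff_less mod_less_divisor)
    ultimately have "(?a + n) div e = ?a div e + c" by simp
    moreover have "n div e < c" using c
      by (metis lessI less_mult_imp_div_less mult.commute)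
    ultimately show ?thesis unfolding card_multiples_shift[OF e(1)] using True by simp
  next
    case False
    then show ?thesis using card_multiples_shift_ge[OF e(1), of "n" ?a] by auto
  qed
  then show "size (filter_mset (\<lambda>x. d dvd x) (cox_degrees (Cox_D (Suc n)))) \<le>
      size (filter_mset (\<lambda>x. d dvd x + k * (2 * n)) (cox_degrees (Cox_D (Suc n))))"
    using card_multiples_shift[OF e(1), of "n" 0]
    by (auto simp: size_filter_image_mset_set e(3) iff split: if_splits)
qed

text \<open>If d divides m, the shift changes nothing. Otherwise only d = 2 with m odd matters, and
  then 2 + km or m + km is even according to the parity of k.\<close>

lemma divisibility_dominated_I2: "divisibility_dominated k m (cox_degrees (Cox_I2 m))"
  unfolding divisibility_dominated_def
proof (intro allI impI)
  fix d :: nat assume "d \<ge> 2"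
  then have "d dvd 2 \<longleftrightarrow> d = 2" by (auto dest: dvd_imp_le)
  then show "size (filter_mset (\<lambda>x. d dvd x) (cox_degrees (Cox_I2 m))) \<le>
      size (filter_mset (\<lambda>x. d dvd x + k * m) (cox_degrees (Cox_I2 m)))"
    by auto
qed

text \<open>
  Only the divisors of degrees that do not divide \<open>h\<close> need checking; they are listed in \<open>es\<close>.
\<close>

lemma divisibility_dominated_mset:
  assumes es: "\<forall>d\<in>set [2..<Suc h]. d dvd h \<or> d \<in> set es \<or> (\<forall>x\<in>set ds. \<not> d dvd x)"
    and check: "\<forall>d\<in>set es. \<forall>r<d.
      length (filter (\<lambda>x. d dvd x) ds) \<le> length (filter (\<lambda>x. d dvd x + r * h) ds)"
    and bounds: "\<forall>x\<in>set ds. 0 < x \<and> x \<le> h"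
  shows "divisibility_dominated k h (mset ds)"
  unfolding divisibility_dominated_def
proof (intro allI impI)
  fix d :: nat assume d: "d \<ge> 2"
  \<comment> \<open>Only k modulo d matters, which reduces all k to the finitely many residues r in
    \<open>check\<close>.\<close>
  have iff: "d dvd x + k * h \<longleftrightarrow> d dvd x + k mod d * h" for x
    unfolding dvd_eq_mod_eq_0 by (metis mod_add_right_eq mod_mult_left_eq)
  have "length (filter (\<lambda>x. d dvd x) ds) \<le> length (filter (\<lambda>x. d dvd x + k * h) ds)"
  proof -
    consider "d dvd h" | "\<forall>x\<in>set ds. \<not> d dvd x" | x where "\<not> d dvd h" "x \<in> set ds" "d dvd x"
      by blast
    then show ?thesis
    proof cases
      case 1
      then have "d dvd x + k * h \<longleftrightarrow> d dvd x" for x by (simp add: dvd_add_left_iff)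
      then show ?thesis by simp
    next
      case 2
      then have "filter (\<lambda>x. d dvd x) ds = []" by (simp only: filter_empty_conv)
      then show ?thesis by simp
    next
      case (3 x)
      then have "d \<le> h" using bounds by (meson dvd_imp_le le_trans)
      then have "d \<in> set [2..<Suc h]" using d by (simp del: upt_Suc)
      then have "d \<in> set es" using es 3 by blast
      moreover have "k mod d < d" using d by simp
      ultimately show ?thesis using check unfolding iff by blast
    qed
  qed
  then show "size (filter_mset (\<lambda>x. d dvd x) (mset ds)) \<le>
      size (filter_mset (\<lambda>x. d dvd x + k * h) (mset ds))"
    by (simp flip: mset_filter)
qed

text \<open>Unrolls a bounded quantifier into single instances, so that the residue checks below
  become evaluation by \<open>simp\<close>.\<close>

lemma all_less_numeral:
  "(\<forall>r<numeral n. P r) \<longleftrightarrow> P (pred_numeral n) \<and> (\<forall>r<pred_numeral n. P r)"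
  by (simp add: numeral_eq_Suc All_less_Suc)

lemma divisibility_dominated_exceptional:
  "divisibility_dominated k 12 (cox_degrees Cox_E6)"
  "divisibility_dominated k 18 (cox_degrees Cox_E7)"
  "divisibility_dominated k 30 (cox_degrees Cox_E8)"
  "divisibility_dominated k 12 (cox_degrees Cox_F4)"
  "divisibility_dominated k 10 (cox_degrees Cox_H3)"
  "divisibility_dominated k 30 (cox_degrees Cox_H4)"
proof -
  have "divisibility_dominated k 12 (mset [2, 5, 6, 8, 9, 12])"
    by (rule divisibility_dominated_mset[where es = "[5, 8, 9]"])
      (simp_all add: all_less_numeral)
  then show "divisibility_dominated k 12 (cox_degrees Cox_E6)" by simp
  have "divisibility_dominated k 18 (mset [2, 6, 8, 10, 12, 14, 18])"
    by (rule divisibility_dominated_mset[where es = "[4, 5, 7, 8, 10, 12, 14]"])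
      (simp_all add: all_less_numeral)
  then show "divisibility_dominated k 18 (cox_degrees Cox_E7)" by simp
  have "divisibility_dominated k 30 (mset [2, 8, 12, 14, 18, 20, 24, 30])"
    by (rule divisibility_dominated_mset[where es = "[4, 7, 8, 9, 12, 14, 18, 20, 24]"])
      (simp_all add: all_less_numeral)
  then show "divisibility_dominated k 30 (cox_degrees Cox_E8)" by simp
  have "divisibility_dominated k 12 (mset [2, 6, 8, 12])"
    by (rule divisibility_dominated_mset[where es = "[8]"])
      (simp_all add: all_less_numeral)
  then show "divisibility_dominated k 12 (cox_degrees Cox_F4)" by simp
  have "divisibility_dominated k 10 (mset [2, 6, 10])"
    by (rule divisibility_dominated_mset[where es = "[3, 6]"])
      (simp_all add: all_less_numeral)
  then show "divisibility_dominated k 10 (cox_degrees Cox_H3)" by simp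
  have "divisibility_dominated k 30 (mset [2, 12, 20, 30])"
    by (rule divisibility_dominated_mset[where es = "[4, 12, 20]"])
      (simp_all add: all_less_numeral)
  then show "divisibility_dominated k 30 (cox_degrees Cox_H4)" by simp
qed

section \<open>From sorted degrees to multisets, and conclusion\<close>

lemma prod_nth_sorted_list_of_multiset:
  "(\<Prod>j = 1..size M. f (sorted_list_of_multiset M ! (j - 1))) = (\<Prod>x\<in>#M. f x)"
proof -
  let ?xs = "sorted_list_of_multiset M"
  have len: "size M = length ?xs" by (metis mset_sorted_list_of_multiset size_mset)
  have "(\<Prod>j = 1..size M. f (?xs ! (j - 1))) = (\<Prod>j<length ?xs. f (?xs ! j))"
    unfolding len by (rule prod.reindex_bij_witness[of _ Suc "\<lambda>j. j - 1"]) auto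
  also have "\<dots> = prod_list (map f ?xs)"
    by (simp add: prod.list_conv_set_nth atLeast0LessThan)
  also have "\<dots> = (\<Prod>x\<in>#M. f x)"
    by (simp flip: prod_mset_prod_list)
  finally show ?thesis .
qed

lemma nth_sorted_list_of_multiset_last:
  assumes "h \<in># M" "\<And>x. x \<in># M \<Longrightarrow> x \<le> h"
  shows "sorted_list_of_multiset M ! (size M - 1) = h"
proof -
  let ?xs = "sorted_list_of_multiset M"
  have len: "size M = length ?xs" by (metis mset_sorted_list_of_multiset size_mset)
  obtain i where i: "i < length ?xs" "?xs ! i = h"
    using assms(1) by (metis in_set_conv_nth set_sorted_list_of_multiset)
  have "h \<le> ?xs ! (length ?xs - 1)"
    using i sorted_nth_mono[of ?xs i "length ?xs - 1"] by auto
  moreover have "?xs ! (length ?xs - 1) \<in># M"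
    using i by (metis diff_less length_pos_if_in_set nth_mem set_sorted_list_of_multiset zero_less_one)
  ultimately show ?thesis using assms(2) len by (simp add: antisym)
qed

lemma lucas_cat_nat_poly:
  assumes W: "finite_irreducible_coxeter W"
    and h: "h \<in># cox_degrees W" "\<And>d. d \<in># cox_degrees W \<Longrightarrow> d \<le> h"
    and dom: "divisibility_dominated k h (cox_degrees W)"
  shows "lucas_cat k W \<in> nat_polys"
proof -
  let ?D = "cox_degrees W"
  have "cox_degree W (cox_rank W) = h"
    using nth_sorted_list_of_multiset_last[OF h] size_cox_degrees[OF W] by (simp add: cox_degree_def)
  then have cat: "lucas_cat k W = (\<Prod>x\<in>#?D. to_fract (lucas (x + k * h)) / to_fract (lucas x))"
    using prod_nth_sorted_list_of_multiset[of "\<lambda>x. to_fract (lucas (x + k * h)) / to_fract (lucas x)" ?D]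
      size_cox_degrees[OF W] by (simp add: lucas_cat_def cox_degree_def)
  have frac: "(\<Prod>x\<in>#M. to_fract (lucas (f x)) / to_fract (lucas x)) =
      to_fract (\<Prod>x\<in>#image_mset f M. lucas x) / to_fract (\<Prod>x\<in>#M. lucas x)"
    for f and M :: "nat multiset"
    by (induction M) auto
  obtain q where q: "(\<Prod>x\<in>#{#x + k * h. x \<in># ?D#}. lucas x) = q * (\<Prod>x\<in>#?D. lucas x)"
      "\<And>i j. coeff (coeff q j) i \<ge> 0"
  proof (rule lucas_quotient_nat_poly[of "{#x + k * h. x \<in># ?D#}" ?D])
    show "size (filter_mset (\<lambda>x. d dvd x) ?D) \<le>
        size (filter_mset (\<lambda>x. d dvd x) {#x + k * h. x \<in># ?D#})" if "d \<ge> 2" for d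
      using dom that by (simp add: divisibility_dominated_def filter_mset_image_mset)
  qed (use cox_degrees_pos[OF W] in auto)
  \<comment> \<open>Nonvanishing of the denominator makes the quotient in the fraction field cancel
    to q.\<close>
  have "(\<Prod>x\<in>#?D. lucas x) \<noteq> 0"
    using cox_degrees_pos[OF W] lucas_nonzero by (auto simp: prod_mset_zero_iff)
  then have "lucas_cat k W = to_fract q" unfolding cat frac q(1) by simp
  then show ?thesis using q(2) by (auto simp: nat_polys_def)
qed

theorem theorem3p4:
  fixes W :: coxeter_type and k :: nat
  assumes "finite_irreducible_coxeter W"
    and "k > 0"
  shows "lucas_cat k W \<in> nat_polys"
proof (cases W)
  case (Cox_A n)
  then show ?thesis
    using assms(1) by (intro lucas_cat_nat_poly[OF assms(1), of "n + 1"])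
      (use divisibility_dominated_A in auto)
next
  case (Cox_B n)
  then show ?thesis
    using assms(1) by (intro lucas_cat_nat_poly[OF assms(1), of "2 * n"])
      (use divisibility_dominated_B in auto)
next
  case (Cox_D n)
  \<comment> \<open>The largest degree is 2n - 2 = 2m; the bound on n ensures that the remaining
    degree n does not exceed it.\<close>
  then obtain m where "n = Suc m" using assms(1) by (cases n) auto
  then show ?thesis
    using assms(1) Cox_D by (intro lucas_cat_nat_poly[OF assms(1), of "2 * m"])
      (use divisibility_dominated_D[of k m] in auto)
next
  case (Cox_I2 m)
  then show ?thesis
    using assms(1) by (intro lucas_cat_nat_poly[OF assms(1), of m])
      (use divisibility_dominated_I2 in auto)
next
  case Cox_E6
  then show ?thesis
    by (intro lucas_cat_nat_poly[OF assms(1), of 12])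
      (use divisibility_dominated_exceptional in auto)
next
  case Cox_E7
  then show ?thesis
    by (intro lucas_cat_nat_poly[OF assms(1), of 18])
      (use divisibility_dominated_exceptional in auto)
next
  case Cox_E8
  then show ?thesis
    by (intro lucas_cat_nat_poly[OF assms(1), of 30])
      (use divisibility_dominated_exceptional in auto)
next
  case Cox_F4
  then show ?thesis
    by (intro lucas_cat_nat_poly[OF assms(1), of 12])
      (use divisibility_dominated_exceptional in auto)
next
  case Cox_H3
  then show ?thesis
    by (intro lucas_cat_nat_poly[OF assms(1), of 10])
      (use divisibility_dominated_exceptional in auto)
next
  case Cox_H4
  then show ?thesis
    by (intro lucas_cat_nat_poly[OF assms(1), of 30])
      (use divisibility_dominated_exceptional in auto)
qed

end
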